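(* Let $k,\ell\geq 2$ and $0\leq \epsilon < 2/\ell$ be fixed. Then for every $n$ there exists a $2$-colorable $k$-uniform hypergraph $H$ on $n$ vertices with $\Omega(n^{k-\epsilon})$ edges such that, if $R$ is a collection of $o\big(n^{\ell\epsilon/2}\big)$ random $\ell$-tuples on its vertex set, then $H+R$ is almost surely $2$-colorable.
   Context: A $k$-uniform hypergraph is a pair $(V,E)$ with $E$ a family of distinct $k$-subsets of $V$. A collection of $m$ random $\ell$-tuples on an $n$-element set $V$ consists of $m$ $\ell$-element subsets of $V$, each chosen independently and uniformly at random among all $\binom{n}{\ell}$ such subsets. $H+R$ denotes the hypergraph on $V$ whose edges are the edges of $H$ together with the $\ell$-sets in $R$. A $2$-coloring of a hypergraph is a partition of its vertex set into two classes such that no edge is monochromatic; the hypergraph is $2$-colorable if such a coloring exists. "Almost surely" means with probability tending to $1$ as $n\to\infty$. Asymptotic notation is as $n\to\infty$ with $k,\ell,\epsilon$ fixed; $a_n=o(b_n)$ means $a_n/b_n\to 0$. *)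

theory Defs
  imports "HOL-Probability.Probability"
begin

text \<open>A hypergraph is a pair of a vertex set and a set of edges.\<close>

type_synonym 'a hypergraph = "'a set \<times> 'a set set"

definition subsets_of_card :: "'a set \<Rightarrow> nat \<Rightarrow> 'a set set" where
  "subsets_of_card V l = {e. e \<subseteq> V \<and> card e = l}"

definition uniform_hypergraph :: "nat \<Rightarrow> 'a hypergraph \<Rightarrow> bool" where
  "uniform_hypergraph k H \<longleftrightarrow> finite (fst H) \<and> snd H \<subseteq> subsets_of_card (fst H) k"

text \<open>The colour classes are allowed to be empty.\<close>

definition two_coloring :: "'a hypergraph \<Rightarrow> 'a set \<Rightarrow> 'a set \<Rightarrow> bool" where
  "two_coloring H A B \<longleftrightarrow>
     A \<union> B = fst H \<and> A \<inter> B = {} \<and> (\<forall>e\<in>snd H. \<not> e \<subseteq> A \<and> \<not> e \<subseteq> B)"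

definition two_colorable :: "'a hypergraph \<Rightarrow> bool" where
  "two_colorable H \<longleftrightarrow> (\<exists>A B. two_coloring H A B)"

text \<open>
  The tuples are the values at \<open>0, \<dots>, m - 1\<close> of a random function; repetitions are possible.
  Elsewhere the function takes the default value \<open>{}\<close>, which is not one of the tuples.
  The distribution is meaningful only if \<open>V\<close> is finite and has at least \<open>l\<close> elements.
\<close>

definition random_tuples :: "'a set \<Rightarrow> nat \<Rightarrow> nat \<Rightarrow> (nat \<Rightarrow> 'a set) pmf" where
  "random_tuples V l m = Pi_pmf {..<m} {} (\<lambda>_. pmf_of_set (subsets_of_card V l))"

definition add_edges :: "'a hypergraph \<Rightarrow> 'a set set \<Rightarrow> 'a hypergraph" where
  "add_edges H F = (fst H, snd H \<union> F)"

end

(* H consists of the k-sets that meet both X and Y, two disjoint sets of about n^(1-\<epsilon>/2) vertices, so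
   any colouring that gives X one colour and Y the other is proper for H. It extends to the random
   tuples R as soon as every nonempty subfamily S of R has a vertex outside P = X \<union> Y that lies in
   exactly one member of S. For a fixed S with t members let U be the set of covered vertices outside
   P. If S is bad, the members of S lie in P \<union> U and cover each vertex of U twice, so S has weight
   at least 1 when each member e contributes z^|e \<inter> U| and each vertex of U costs z^-2. Taking
   expectations with z = sqrt(n/t) and summing over U bounds the probability that S is bad by
   (C (|P|/n + sqrt(t/n)))^(lt); with m = o(n^(l\<epsilon>/2)) <= o(n), the union bound over S is a geometric
   series with ratio O(m (|P|/n)^l + m/n) = o(1). *)

theory Submission
  imports Defs "HOL-Real_Asymp.Real_Asymp"
begin

section \<open>Colourings from private vertices\<close>

text \<open>\<open>S\<close> is a set of indices, so that coinciding tuples count separately. The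
  negation says that some member of \<open>S\<close> has a private vertex outside \<open>P\<close>:
  its colour is still free and affects no other member. A family lying inside \<open>P\<close>
  counts as doubly covered, since its colours are already fixed.\<close>

definition doubly_covered :: "'a set \<Rightarrow> ('i \<Rightarrow> 'a set) \<Rightarrow> 'i set \<Rightarrow> bool" where
  "doubly_covered P R S \<longleftrightarrow> (\<forall>v\<in>(\<Union>i\<in>S. R i) - P. 2 \<le> card {i\<in>S. v \<in> R i})"

lemma not_doubly_coveredE:
  assumes "\<not> doubly_covered P R S" and "finite S"
  obtains i v where "i \<in> S" "v \<in> R i" "v \<notin> P" "\<And>j. j \<in> S \<Longrightarrow> j \<noteq> i \<Longrightarrow> v \<notin> R j"
proof -
  from assms(1) obtain i v where iv: "i \<in> S" "v \<in> R i" "v \<notin> P" "\<not> 2 \<le> card {i\<in>S. v \<in> R i}"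
    unfolding doubly_covered_def by auto
  have "v \<notin> R j" if "j \<in> S" "j \<noteq> i" for j
  proof
    assume "v \<in> R j"
    hence "{i, j} \<subseteq> {i\<in>S. v \<in> R i}" using iv that by auto
    hence "card {i, j} \<le> card {i\<in>S. v \<in> R i}" using assms(2) by (intro card_mono) auto
    thus False using iv that by simp
  qed
  thus ?thesis using that iv by blast
qed

text \<open>An edge with a private vertex \<open>v\<close> is removed, the rest is coloured, and then \<open>v\<close> receives
  the colour opposite to that of another vertex of the edge.\<close>

lemma coloring_extends:
  assumes "finite I" and "\<And>i. i \<in> I \<Longrightarrow> finite (R i) \<and> 2 \<le> card (R i)"
    and "X \<inter> Y = {}"
    and "\<And>S. S \<subseteq> I \<Longrightarrow> S \<noteq> {} \<Longrightarrow> \<not> doubly_covered (X \<union> Y) R S"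
  shows "\<exists>A. X \<subseteq> A \<and> A \<inter> Y = {} \<and> (\<forall>i\<in>I. \<not> R i \<subseteq> A \<and> R i \<inter> A \<noteq> {})"
  using assms
proof (induction I rule: finite_psubset_induct)
  case (psubset I)
  show ?case
  proof (cases "I = {}")
    case True
    thus ?thesis using psubset.prems by (intro exI[of _ X]) auto
  next
    case False
    then obtain i v where iv: "i \<in> I" "v \<in> R i" "v \<notin> X \<union> Y"
        "\<And>j. j \<in> I \<Longrightarrow> j \<noteq> i \<Longrightarrow> v \<notin> R j"
      using psubset.prems(3)[of I] psubset.hyps not_doubly_coveredE[of "X \<union> Y" R I] by auto
    have "\<exists>A. X \<subseteq> A \<and> A \<inter> Y = {} \<and> (\<forall>j\<in>I - {i}. \<not> R j \<subseteq> A \<and> R j \<inter> A \<noteq> {})"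
      using iv(1) psubset.prems by (intro psubset.IH) auto
    then obtain A where A: "X \<subseteq> A" "A \<inter> Y = {}"
        "\<And>j. j \<in> I \<Longrightarrow> j \<noteq> i \<Longrightarrow> \<not> R j \<subseteq> A \<and> R j \<inter> A \<noteq> {}"
      by auto
    have "R i \<noteq> {v}" using psubset.prems(1)[OF iv(1)] by auto
    then obtain w where w: "w \<in> R i" "w \<noteq> v" using iv(2) by auto
    define A' where "A' = (if w \<in> A then A - {v} else insert v A)"
    have "\<not> R j \<subseteq> A' \<and> R j \<inter> A' \<noteq> {}" if "j \<in> I" for j
    proof (cases "j = i")
      case True
      thus ?thesis using w iv(2) by (auto simp: A'_def)
    next
      case False
      thus ?thesis using A(3)[OF that False] iv(4)[OF that False] by (auto simp: A'_def)
    qed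
    moreover have "X \<subseteq> A'" "A' \<inter> Y = {}" using A(1,2) iv(3) by (auto simp: A'_def)
    ultimately show ?thesis by blast
  qed
qed

section \<open>The probability that a family of random tuples is doubly covered\<close>

lemma finite_subsets_of_card [simp, intro]: "finite V \<Longrightarrow> finite (subsets_of_card V l)"
  by (rule finite_subset[of _ "Pow V"]) (auto simp: subsets_of_card_def)

lemma card_subsets_of_card: "finite V \<Longrightarrow> card (subsets_of_card V l) = card V choose l"
  unfolding subsets_of_card_def by (rule n_subsets)

text \<open>The left side is the elementary symmetric polynomial of degree \<open>l\<close> in the
  weights, and each of its monomials occurs in the expansion of the power. The induction uses the
  recursion e_{j+1}(W + x) = e_{j+1}(W) + w(x) e_j(W), which splits the subsets by whether they
  contain \<open>x\<close>.\<close>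

lemma sum_prod_subsets_of_card_le:
  fixes w :: "'a \<Rightarrow> real"
  assumes "finite W" and "\<And>v. v \<in> W \<Longrightarrow> 0 \<le> w v"
  shows "(\<Sum>e\<in>subsets_of_card W l. \<Prod>v\<in>e. w v) \<le> (\<Sum>v\<in>W. w v) ^ l"
  using assms
proof (induction W arbitrary: l rule: finite_induct)
  case empty
  have "subsets_of_card {} l = (if l = 0 then {{}} else {} :: 'a set set)"
    by (auto simp: subsets_of_card_def)
  thus ?case by simp
next
  case (insert x W)
  show ?case
  proof (cases l)
    case 0
    have "subsets_of_card (insert x W) 0 = {{}}"
      using insert.hyps finite_subset[of _ "insert x W"] by (auto simp: subsets_of_card_def)
    thus ?thesis using 0 by simp
  next
    case (Suc j)
    let ?s = "\<Sum>v\<in>W. w v"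
    have s0: "0 \<le> ?s" using insert.prems by (intro sum_nonneg) auto
    have x0: "0 \<le> w x" using insert.prems by auto
    have fin: "finite e" "x \<notin> e" if "e \<subseteq> W" for e
      using that insert.hyps finite_subset by auto
    have eq: "subsets_of_card (insert x W) (Suc j) =
        subsets_of_card W (Suc j) \<union> insert x ` subsets_of_card W j" (is "?L = ?R")
    proof
      show "?R \<subseteq> ?L" using fin by (auto simp: subsets_of_card_def)
      show "?L \<subseteq> ?R"
      proof
        fix e assume e: "e \<in> ?L"
        show "e \<in> ?R"
        proof (cases "x \<in> e")
          case True
          hence "e = insert x (e - {x})" by auto
          moreover have "e - {x} \<in> subsets_of_card W j"
            using e True by (auto simp: subsets_of_card_def)
          ultimately show ?thesis by blast
        qed (use e in \<open>auto simp: subsets_of_card_def\<close>)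
      qed
    qed
    have "(\<Sum>e\<in>subsets_of_card (insert x W) (Suc j). \<Prod>v\<in>e. w v) =
        (\<Sum>e\<in>subsets_of_card W (Suc j). \<Prod>v\<in>e. w v) +
        (\<Sum>e\<in>insert x ` subsets_of_card W j. \<Prod>v\<in>e. w v)"
      unfolding eq using insert.hyps by (intro sum.union_disjoint) (auto simp: subsets_of_card_def)
    also have "(\<Sum>e\<in>insert x ` subsets_of_card W j. \<Prod>v\<in>e. w v) =
        (\<Sum>e\<in>subsets_of_card W j. w x * (\<Prod>v\<in>e. w v))"
    proof (subst sum.reindex)
      show "inj_on (insert x) (subsets_of_card W j)"
      proof (rule inj_onI)
        fix e e' assume "e \<in> subsets_of_card W j" "e' \<in> subsets_of_card W j"
          and "insert x e = insert x e'"
        thus "e = e'" using fin(2) insert_ident[of x e e'] by (simp add: subsets_of_card_def)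
      qed
    qed (use fin in \<open>auto simp: subsets_of_card_def intro!: sum.cong\<close>)
    also have "\<dots> = w x * (\<Sum>e\<in>subsets_of_card W j. \<Prod>v\<in>e. w v)"
      by (simp add: sum_distrib_left)
    also have "(\<Sum>e\<in>subsets_of_card W (Suc j). \<Prod>v\<in>e. w v) + \<dots> \<le> ?s ^ Suc j + w x * ?s ^ j"
      using insert.prems x0 by (intro add_mono mult_left_mono insert.IH) auto
    also have "\<dots> = (?s + w x) * ?s ^ j" by (simp add: algebra_simps)
    also have "\<dots> \<le> (?s + w x) * (?s + w x) ^ j"
      using s0 x0 by (intro mult_left_mono power_mono) auto
    also have "\<dots> = (\<Sum>v\<in>insert x W. w v) ^ l"
      using insert.hyps Suc by (simp add: add.commute)
    finally show ?thesis using Suc by simp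
  qed
qed

text \<open>Give the vertices of \<open>U\<close> weight \<open>z\<close> and those of
  \<open>P\<close> weight 1: then \<open>z ^ card (e \<inter> U)\<close> is the product of the
  weights over \<open>e\<close>, and the total weight is the base on the right.\<close>

lemma sum_power_card_Int_le:
  fixes z :: real
  assumes "finite V" "P \<subseteq> V" "U \<subseteq> V" "P \<inter> U = {}" "0 \<le> z"
  shows "(\<Sum>e\<in>subsets_of_card V l. if e \<subseteq> P \<union> U then z ^ card (e \<inter> U) else 0)
    \<le> (real (card P) + z * real (card U)) ^ l"
proof -
  let ?w = "\<lambda>v. if v \<in> U then z else 1"
  have fin: "finite P" "finite U" using assms by (auto intro: finite_subset)
  have "(\<Sum>e\<in>subsets_of_card V l. if e \<subseteq> P \<union> U then z ^ card (e \<inter> U) else 0) =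
      (\<Sum>e\<in>subsets_of_card (P \<union> U) l. z ^ card (e \<inter> U))"
    using assms by (intro sum.mono_neutral_cong_right) (auto simp: subsets_of_card_def)
  also have "\<dots> = (\<Sum>e\<in>subsets_of_card (P \<union> U) l. \<Prod>v\<in>e. ?w v)"
    using fin finite_subset[of _ "P \<union> U"]
    by (intro sum.cong refl) (auto simp: subsets_of_card_def prod.If_cases)
  also have "\<dots> \<le> (\<Sum>v\<in>P \<union> U. ?w v) ^ l"
    using fin assms by (intro sum_prod_subsets_of_card_le) auto
  also have "(\<Sum>v\<in>P \<union> U. ?w v) = real (card P) + z * real (card U)"
  proof -
    have "(\<Sum>v\<in>P \<union> U. ?w v) = (\<Sum>v\<in>P. ?w v) + (\<Sum>v\<in>U. ?w v)"
      using fin assms by (intro sum.union_disjoint) auto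
    also have "(\<Sum>v\<in>P. ?w v) = (\<Sum>v\<in>P. 1)" using assms by (intro sum.cong) auto
    finally show ?thesis by (simp add: mult.commute)
  qed
  finally show ?thesis .
qed

text \<open>Counting the incidences between \<open>U\<close> and the tuples in two ways gives
  \<open>2 * card U \<le> (\<Sum>i\<in>S. card (R i \<inter> U))\<close>, and
  \<open>z \<ge> 1\<close> turns this into the claim. For this \<open>U\<close> the zero branch
  never occurs; it matters later, when \<open>U\<close> is fixed and the tuples are random, because
  confining each tuple to \<open>P \<union> U\<close> keeps the expected weight small.\<close>

lemma doubly_covered_weight:
  fixes z :: real
  assumes "finite S" "\<And>i. i \<in> S \<Longrightarrow> finite (R i)" "doubly_covered P R S" "1 \<le> z"
    and U: "U = (\<Union>i\<in>S. R i) - P"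
  shows "1 \<le> (1 / z) ^ (2 * card U) *
    (\<Prod>i\<in>S. if R i \<subseteq> P \<union> U then z ^ card (R i \<inter> U) else 0)"
proof -
  have finU: "finite U" using assms by auto
  have "2 * card U = (\<Sum>v\<in>U. 2)" by simp
  also have "\<dots> \<le> (\<Sum>v\<in>U. card {i\<in>S. v \<in> R i})"
    using assms(3) unfolding doubly_covered_def U by (intro sum_mono) auto
  also have "\<dots> = (\<Sum>v\<in>U. \<Sum>i\<in>S. if v \<in> R i then 1 else 0)"
    using assms(1) by (intro sum.cong refl) (simp add: sum.If_cases Int_def)
  also have "\<dots> = (\<Sum>i\<in>S. \<Sum>v\<in>U. if v \<in> R i then 1 else 0)" by (rule sum.swap)
  also have "\<dots> = (\<Sum>i\<in>S. card (R i \<inter> U))"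
    using finU by (intro sum.cong refl) (simp add: sum.If_cases Int_def conj_commute)
  finally have le: "2 * card U \<le> (\<Sum>i\<in>S. card (R i \<inter> U))" .
  have "(\<Prod>i\<in>S. if R i \<subseteq> P \<union> U then z ^ card (R i \<inter> U) else 0) =
      (\<Prod>i\<in>S. z ^ card (R i \<inter> U))"
    by (intro prod.cong) (auto simp: U)
  also have "\<dots> = z ^ (\<Sum>i\<in>S. card (R i \<inter> U))" by (rule power_sum[symmetric])
  finally have "(\<Prod>i\<in>S. if R i \<subseteq> P \<union> U then z ^ card (R i \<inter> U) else 0) \<ge> z ^ (2 * card U)"
    using power_increasing[OF le assms(4)] by simp
  hence "(1 / z) ^ (2 * card U) * z ^ (2 * card U) \<le> (1 / z) ^ (2 * card U) *
      (\<Prod>i\<in>S. if R i \<subseteq> P \<union> U then z ^ card (R i \<inter> U) else 0)"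
    using assms(4) by (intro mult_left_mono) auto
  thus ?thesis using assms(4) by (simp add: power_one_over)
qed

section \<open>Support and independence of the random tuples\<close>

lemma set_pmf_random_tuples:
  assumes "finite V" "l \<le> card V" "R \<in> set_pmf (random_tuples V l m)" "i < m"
  shows "R i \<subseteq> V" "card (R i) = l" "finite (R i)"
proof -
  have "card (subsets_of_card V l) > 0"
    using assms by (simp add: card_subsets_of_card)
  hence ne: "subsets_of_card V l \<noteq> {}" by auto
  have "R i \<in> subsets_of_card V l"
    using assms ne unfolding random_tuples_def by (auto simp: set_Pi_pmf PiE_dflt_def)
  thus "R i \<subseteq> V" "card (R i) = l" by (auto simp: subsets_of_card_def)
  thus "finite (R i)" using assms(1) finite_subset by auto
qed

lemma expectation_prod_random_tuples:
  fixes f :: "'a set \<Rightarrow> real"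
  assumes "finite V" "l \<le> card V" "S \<subseteq> {..<m}" "\<And>e. 0 \<le> f e"
  shows "measure_pmf.expectation (random_tuples V l m) (\<lambda>R. \<Prod>i\<in>S. f (R i)) =
    ((\<Sum>e\<in>subsets_of_card V l. f e) / real (card V choose l)) ^ card S"
proof -
  have "card (subsets_of_card V l) > 0"
    using assms by (simp add: card_subsets_of_card)
  hence ne: "subsets_of_card V l \<noteq> {}" and fin: "finite (subsets_of_card V l)"
    using assms by auto
  \<comment> \<open>Factors 1 at the indices outside \<open>S\<close> extend the product to all
    coordinates, where independence gives the product rule.\<close>
  let ?f = "\<lambda>i e. if i \<in> S then f e else 1"
  have "(\<Prod>i\<in>S. f (R i)) = (\<Prod>i<m. ?f i (R i))" for R
    using assms(3) by (intro prod.mono_neutral_cong_left) auto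
  hence "measure_pmf.expectation (random_tuples V l m) (\<lambda>R. \<Prod>i\<in>S. f (R i)) =
      measure_pmf.expectation (random_tuples V l m) (\<lambda>R. \<Prod>i<m. ?f i (R i))"
    by simp
  also have "\<dots> = (\<Prod>i<m. measure_pmf.expectation (pmf_of_set (subsets_of_card V l)) (?f i))"
    unfolding random_tuples_def using assms ne fin
    by (intro expectation_prod_Pi_pmf)
      (auto simp: set_pmf_of_set[OF ne fin] intro!: integrable_measure_pmf_finite)
  also have "\<dots> = (\<Prod>i\<in>S. measure_pmf.expectation (pmf_of_set (subsets_of_card V l)) f)"
    using assms(3) by (intro prod.mono_neutral_cong_right) auto
  also have "\<dots> = (\<Sum>e\<in>subsets_of_card V l. f e) ^ card S / real (card V choose l) ^ card S"
    using ne fin assms by (simp add: integral_pmf_of_set card_subsets_of_card power_divide)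
  finally show ?thesis by (simp add: power_divide)
qed

lemma finite_set_pmf_random_tuples [simp]:
  assumes "finite V" "l \<le> card V"
  shows "finite (set_pmf (random_tuples V l m))"
proof -
  have "card (subsets_of_card V l) > 0"
    using assms by (simp add: card_subsets_of_card)
  hence ne: "subsets_of_card V l \<noteq> {}" by auto
  have "finite (PiE_dflt {..<m} {} (\<lambda>_. subsets_of_card V l))"
    using assms by (intro finite_PiE_dflt) auto
  thus ?thesis
    using assms ne unfolding random_tuples_def by (simp add: set_Pi_pmf o_def)
qed

section \<open>Probability bound for one fixed index set\<close>

lemma sum_power_card_Pow_le:
  fixes c :: real
  assumes "finite V" "0 \<le> c"
  shows "(\<Sum>U\<in>Pow V. c ^ card U) \<le> exp (c * card V)"
proof -
  \<comment> \<open>Expand a product of \<open>card V\<close> factors \<open>1 + c\<close> over the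
    subsets of \<open>V\<close>.\<close>
  have "(\<Sum>U\<in>Pow V. c ^ card U) = (1 + c) ^ card V"
    using prod_add[OF assms(1), of "\<lambda>_. c" "\<lambda>_. 1"] by (simp add: add.commute)
  also have "\<dots> \<le> exp c ^ card V"
    using assms(2) by (intro power_mono) auto
  finally show ?thesis by (simp add: mult.commute flip: exp_of_nat_mult)
qed

text \<open>The probability is at most the expectation of the weight in
  \<open>doubly_covered_weight\<close>, summed over all candidates for \<open>U\<close>. The choice
  z = sqrt(n/t) balances two effects: the costs z^(-2|U|) = (t/n)^|U| sum to at most e^t, while |U|
  <= lt keeps z|U|/n below l sqrt(t/n). The assumption \<open>t \<le> n\<close> ensures z >=
  1.\<close>

lemma prob_doubly_covered_le:
  fixes V P :: "'a set" and l m :: nat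
  defines "n \<equiv> card V"
  assumes V: "finite V" "0 < l" "l \<le> n" "P \<subseteq> V"
    and S: "S \<subseteq> {..<m}" "S \<noteq> {}" "card S = t" "t \<le> n"
  shows "measure_pmf.prob (random_tuples V l m) {R. doubly_covered P R S}
    \<le> (exp 1 * (real l * (real (card P) / n + real l * sqrt (real t / n))) ^ l) ^ t"
proof -
  let ?p = "random_tuples V l m"
  \<comment> \<open>\<open>y\<close> is 1/z. \<open>Q\<close> will bound the expected weight of a
    single tuple, its leading factor \<open>l\<close> coming from (n choose l) >= (n/l)^l.
    \<open>UU\<close> collects the possible sets \<open>U\<close>, since \<open>t\<close> tuples
    cover at most \<open>l * t\<close> vertices.\<close>
  define y where "y = sqrt (real t / n)"
  define Q where "Q = (real l * (real (card P) / n + real l * y)) ^ l"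
  define UU where "UU = {U. U \<subseteq> V - P \<and> card U \<le> l * t}"
  define f where "f U e = (if e \<subseteq> P \<union> U then (1 / y) ^ card (e \<inter> U) else 0)" for U e
  have finS: "finite S" using S(1) finite_subset by blast
  hence t: "0 < t" using S by auto
  have n: "0 < n" using t S by auto
  have y2: "y\<^sup>2 = real t / n" by (simp add: y_def)
  have y0: "0 < y" using t n by (simp add: y_def)
  have y1: "y \<le> 1" using S(4) n by (simp add: y_def)
  have finUU: "finite UU" unfolding UU_def using V(1) by (auto intro: finite_subset[of _ "Pow V"])
  have f0: "0 \<le> f U e" for U e using y0 by (simp add: f_def)
  have ln: "l \<le> card V" using V by (simp add: n_def)
  \<comment> \<open>On the event, the summand of the actual uncovered set is already at least 1; all
    summands are nonnegative.\<close>
  have *: "indicator {R. doubly_covered P R S} R \<le> (\<Sum>U\<in>UU. y ^ (2 * card U) * (\<Prod>i\<in>S. f U (R i)))"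
    if R: "R \<in> set_pmf ?p" for R
  proof (cases "doubly_covered P R S")
    case True
    note R' = set_pmf_random_tuples[OF V(1) ln R]
    define U where "U = (\<Union>i\<in>S. R i) - P"
    have "card U \<le> card (\<Union>i\<in>S. R i)"
      unfolding U_def using finS R'(3) S(1) by (intro card_mono) auto
    also have "\<dots> \<le> (\<Sum>i\<in>S. card (R i))" using finS by (rule card_UN_le)
    also have "\<dots> = (\<Sum>i\<in>S. l)" using R'(2) S(1) by (intro sum.cong) auto
    finally have "card U \<le> l * t" using S by (simp add: mult.commute)
    hence U: "U \<in> UU" using R'(1) S(1) by (auto simp: UU_def U_def)
    have "1 \<le> (1 / (1 / y)) ^ (2 * card U) * (\<Prod>i\<in>S. f U (R i))"
      unfolding f_def using y0 y1 finS R'(3) S(1) True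
      by (intro doubly_covered_weight) (auto simp: U_def)
    also have "\<dots> = y ^ (2 * card U) * (\<Prod>i\<in>S. f U (R i))" by simp
    also have "\<dots> \<le> (\<Sum>U\<in>UU. y ^ (2 * card U) * (\<Prod>i\<in>S. f U (R i)))"
      using U finUU f0 y0 by (intro member_le_sum) (auto intro!: mult_nonneg_nonneg prod_nonneg)
    finally show ?thesis using True by simp
  next
    case False
    thus ?thesis using f0 y0 by (auto intro!: sum_nonneg mult_nonneg_nonneg prod_nonneg)
  qed
  have int: "integrable (measure_pmf ?p) g" for g :: "_ \<Rightarrow> real"
    using V ln by (intro integrable_measure_pmf_finite) auto
  have "measure_pmf.prob ?p {R. doubly_covered P R S} =
      measure_pmf.expectation ?p (indicator {R. doubly_covered P R S})" by simp
  also have "\<dots> \<le> measure_pmf.expectation ?p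
      (\<lambda>R. \<Sum>U\<in>UU. y ^ (2 * card U) * (\<Prod>i\<in>S. f U (R i)))"
    using * by (intro integral_mono_AE int) (auto simp: AE_measure_pmf_iff)
  also have "\<dots> = (\<Sum>U\<in>UU. y ^ (2 * card U) *
      measure_pmf.expectation ?p (\<lambda>R. \<Prod>i\<in>S. f U (R i)))"
    by (simp add: Bochner_Integration.integral_sum[OF int])
  also have "\<dots> \<le> (\<Sum>U\<in>UU. y ^ (2 * card U) * Q ^ t)"
  proof (intro sum_mono mult_left_mono)
    fix U assume U: "U \<in> UU"
    have "(\<Sum>e\<in>subsets_of_card V l. f U e) \<le> (real (card P) + 1 / y * real (card U)) ^ l"
      unfolding f_def using U V y0 by (intro sum_power_card_Int_le) (auto simp: UU_def)
    moreover have "(real n / real l) ^ l \<le> real (n choose l)"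
      using V by (intro binomial_ge_n_over_k_pow_k) auto
    ultimately have "(\<Sum>e\<in>subsets_of_card V l. f U e) / real (n choose l) \<le>
        (real (card P) + 1 / y * real (card U)) ^ l / (real n / real l) ^ l"
      using n V y0 by (intro frac_le) (auto intro!: zero_le_power add_nonneg_nonneg)
    also have "\<dots> = (real l * (real (card P) / n + real (card U) / (y * n))) ^ l"
    proof -
      have "(real (card P) + 1 / y * real (card U)) / (real n / real l) =
          real l * (real (card P) / n + real (card U) / (y * n))"
        by (simp add: divide_simps)
      thus ?thesis by (simp only: power_divide[symmetric])
    qed
    also have "\<dots> \<le> Q"
      unfolding Q_def
    proof (intro power_mono mult_left_mono add_left_mono)
      have "real (card U) \<le> real l * real t" using U by (auto simp: UU_def simp flip: of_nat_mult)
      \<comment> \<open>This is y^2 = t/n, written as t = y * (y * n).\<close>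
      also have "\<dots> = real l * y * (y * n)"
        using y2 n by (simp add: power2_eq_square field_simps)
      finally show "real (card U) / (y * n) \<le> real l * y"
        using y0 n by (simp add: divide_le_eq)
    qed (use y0 in auto)
    finally have "((\<Sum>e\<in>subsets_of_card V l. f U e) / real (n choose l)) ^ t \<le> Q ^ t"
      using f0 by (intro power_mono) (auto intro!: divide_nonneg_nonneg sum_nonneg)
    thus "measure_pmf.expectation ?p (\<lambda>R. \<Prod>i\<in>S. f U (R i)) \<le> Q ^ t"
      using S V ln f0 by (subst expectation_prod_random_tuples) (auto simp: n_def)
  qed (use y0 in auto)
  also have "\<dots> = (\<Sum>U\<in>UU. (real t / n) ^ card U) * Q ^ t"
    by (simp add: sum_distrib_right power_mult y2)
  also have "\<dots> \<le> exp 1 ^ t * Q ^ t"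
  proof (rule mult_right_mono)
    \<comment> \<open>The summands are nonnegative, so the sum may run over all subsets of
      \<open>V\<close>, where it factorises.\<close>
    have "(\<Sum>U\<in>UU. (real t / n) ^ card U) \<le> (\<Sum>U\<in>Pow V. (real t / n) ^ card U)"
      using V(1) by (intro sum_mono2) (auto simp: UU_def)
    also have "\<dots> \<le> exp (real t / n * card V)"
      using V(1) by (intro sum_power_card_Pow_le) auto
    also have "\<dots> = exp 1 ^ t" using n by (simp add: n_def exp_of_nat_mult[symmetric])
    finally show "(\<Sum>U\<in>UU. (real t / n) ^ card U) \<le> exp 1 ^ t" .
    show "0 \<le> Q ^ t" using y0 by (simp add: Q_def)
  qed
  finally show ?thesis by (simp add: Q_def y_def power_mult_distrib)
qed

section \<open>Union bound over all index sets\<close>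

lemma power_self_le_exp_fact: "real t ^ t \<le> exp 1 ^ t * fact t"
proof -
  \<comment> \<open>t^t / t! is a single term of the series of exp t.\<close>
  have "(\<Sum>i\<in>{t}. real t ^ i /\<^sub>R fact i) \<le> (\<Sum>i. real t ^ i /\<^sub>R fact i)"
    using exp_converges[of "real t"] by (intro sum_le_suminf) (auto simp: sums_iff)
  also have "\<dots> = exp 1 ^ t"
    using exp_converges[of "real t"] by (simp add: sums_iff exp_of_nat_mult[symmetric])
  finally show ?thesis by (simp add: field_simps)
qed

lemma binomial_le_exp_power:
  assumes "0 < t"
  shows "real (m choose t) \<le> (exp 1 * m / t) ^ t"
proof -
  have "real (m choose t) * real t ^ t \<le> real (m choose t) * (exp 1 ^ t * fact t)"
    by (intro mult_left_mono power_self_le_exp_fact) auto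
  also have "\<dots> = real ((m choose t) * fact t) * exp 1 ^ t" by simp
  also have "\<dots> \<le> real (m ^ t) * exp 1 ^ t"
    by (intro mult_right_mono of_nat_mono binomial_fact_pow) auto
  finally show ?thesis using assms by (simp add: power_divide power_mult_distrib field_simps)
qed

lemma add_power_le: "0 \<le> x \<Longrightarrow> 0 \<le> y \<Longrightarrow> (x + y) ^ l \<le> 2 ^ l * (x ^ l + y ^ l)"
  for x y :: real
proof -
  assume xy: "0 \<le> x" "0 \<le> y"
  have "(x + y) ^ l \<le> (2 * max x y) ^ l" using xy by (intro power_mono) auto
  also have "\<dots> = 2 ^ l * max x y ^ l" by (simp add: power_mult_distrib)
  also have "\<dots> \<le> 2 ^ l * (x ^ l + y ^ l)" using xy by (intro mult_left_mono) (auto simp: max_def)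
  finally show ?thesis .
qed

text \<open>Group the index sets by size \<open>t\<close>. The binomial bound (em/t)^t times the
  bound for one set is the \<open>t\<close>-th power of a base in which the 1/t cancels against y^2
  = t/n. Hence a ratio \<open>\<delta>\<close> independent of \<open>t\<close> suffices, and the
  geometric series starting at t = 1 is at most \<open>2 * \<delta>\<close>. In
  \<open>\<delta>\<close>, one factor e comes from the binomial coefficient and one from the sum
  over \<open>U\<close>; in \<open>2 * l * l\<close>, the 2 comes from splitting the power of a
  sum.\<close>

lemma prob_ex_doubly_covered_le:
  fixes V P :: "'a set" and l m :: nat
  defines "n \<equiv> card V"
  defines "\<delta> \<equiv> exp 2 * real (2 * l * l) ^ l * (real m * (real (card P) / n) ^ l + real m / n)"
  assumes "finite V" "2 \<le> l" "l \<le> n" "P \<subseteq> V" "m \<le> n" "\<delta> \<le> 1 / 2"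
  shows "measure_pmf.prob (random_tuples V l m)
    {R. \<exists>S\<subseteq>{..<m}. S \<noteq> {} \<and> doubly_covered P R S} \<le> 2 * \<delta>"
proof -
  let ?p = "random_tuples V l m"
  have n: "0 < n" using assms by auto
  have d0: "0 \<le> \<delta>" unfolding \<delta>_def by (intro mult_nonneg_nonneg add_nonneg_nonneg) auto
  have fixed_card: "(\<Sum>S\<in>subsets_of_card {..<m} t. measure_pmf.prob ?p {R. doubly_covered P R S}) \<le> \<delta> ^ t"
    if t: "t \<in> {1..m}" for t
  proof -
    define y where "y = sqrt (real t / n)"
    define x where "x = real (card P) / n"
    have x0: "0 \<le> x" by (simp add: x_def)
    have y0: "0 \<le> y" by (simp add: y_def)
    \<comment> \<open>Here \<open>m \<le> n\<close> enters: it gives t <= n for every size that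
      occurs.\<close>
    have y1: "y \<le> 1" using t n assms by (simp add: y_def)
    have "(\<Sum>S\<in>subsets_of_card {..<m} t. measure_pmf.prob ?p {R. doubly_covered P R S}) \<le>
        (\<Sum>S\<in>subsets_of_card {..<m} t. (exp 1 * (real l * (x + real l * y)) ^ l) ^ t)"
      unfolding x_def y_def n_def using assms t
      by (intro sum_mono prob_doubly_covered_le) (auto simp: subsets_of_card_def)
    also have "\<dots> = real (m choose t) * (exp 1 * (real l * (x + real l * y)) ^ l) ^ t"
      by (simp add: card_subsets_of_card)
    also have "\<dots> \<le> (exp 1 * m / t) ^ t * (exp 1 * (real l * (x + real l * y)) ^ l) ^ t"
      using t x0 y0 by (intro mult_right_mono binomial_le_exp_power) auto
    also have "\<dots> = (exp 1 * m / t * (exp 1 * (real l * (x + real l * y)) ^ l)) ^ t"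
      by (simp only: power_mult_distrib)
    also have "\<dots> \<le> \<delta> ^ t"
    proof (rule power_mono)
      have "(x + real l * y) ^ l \<le> 2 ^ l * (x ^ l + (real l * y) ^ l)"
        using x0 y0 by (intro add_power_le) auto
      also have "\<dots> \<le> 2 ^ l * (real l ^ l * x ^ l + real l ^ l * y\<^sup>2)"
      proof (intro mult_left_mono add_mono)
        have "1 * x ^ l \<le> real l ^ l * x ^ l"
          using x0 assms by (intro mult_right_mono one_le_power) auto
        thus "x ^ l \<le> real l ^ l * x ^ l" by simp
        \<comment> \<open>As y <= 1 and l >= 2, the power y^l is at most y^2, which is linear in
          \<open>t\<close>.\<close>
        show "(real l * y) ^ l \<le> real l ^ l * y\<^sup>2"
          unfolding power_mult_distrib using y0 y1 assms
          by (intro mult_left_mono power_decreasing) auto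
      qed auto
      also have "\<dots> = real (2 * l) ^ l * (x ^ l + real t / n)"
        by (simp add: y_def power_mult_distrib algebra_simps)
      finally have "(x + real l * y) ^ l \<le> real (2 * l) ^ l * (x ^ l + real t / n)" .
      from mult_left_mono[OF this, of "real l ^ l"]
      have 1: "(real l * (x + real l * y)) ^ l \<le> real (2 * l * l) ^ l * (x ^ l + real t / n)"
        by (simp add: power_mult_distrib mult_ac)
      have "exp 1 * m / t * (exp 1 * (real l * (x + real l * y)) ^ l) \<le>
          exp 1 * m / t * (exp 1 * (real (2 * l * l) ^ l * (x ^ l + real t / n)))"
        using 1 by (intro mult_left_mono) auto
      also have "\<dots> = exp 2 * real (2 * l * l) ^ l * (m / t * x ^ l + real m / n)"
      proof -
        have "exp 2 = exp 1 * exp (1 :: real)" by (simp flip: exp_add)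
        \<comment> \<open>\<open>E\<close> stands for exp 1 and \<open>u\<close> for x^l; the
          identity shows the cancellation of \<open>t\<close>.\<close>
        moreover have "E * m / t * (E * (c * (u + real t / n))) = E * E * c * (m / t * u + real m / n)"
          for E c u :: real
          using t n by (simp add: divide_simps) (simp add: algebra_simps)
        ultimately show ?thesis by (simp only:)
      qed
      \<comment> \<open>The remaining division by \<open>t\<close> is dropped, since t >= 1.\<close>
      also have "\<dots> \<le> \<delta>"
        unfolding \<delta>_def x_def[symmetric] using t x0
        by (intro mult_left_mono add_right_mono mult_right_mono) (auto simp: divide_le_eq)
      finally show "exp 1 * m / t * (exp 1 * (real l * (x + real l * y)) ^ l) \<le> \<delta>" .
    qed (use x0 y0 in auto)
    finally show ?thesis .
  qed
  have eq: "{R. \<exists>S\<subseteq>{..<m}. S \<noteq> {} \<and> doubly_covered P R S} =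
      (\<Union>t\<in>{1..m}. \<Union>S\<in>subsets_of_card {..<m} t. {R. doubly_covered P R S})" (is "?L = ?R")
  proof
    show "?R \<subseteq> ?L"
    proof
      fix R assume "R \<in> ?R"
      then obtain S where "S \<subseteq> {..<m}" "1 \<le> card S" "doubly_covered P R S"
        by (auto simp: subsets_of_card_def)
      moreover from this have "S \<noteq> {}" by auto
      ultimately show "R \<in> ?L" by blast
    qed
    show "?L \<subseteq> ?R"
    proof
      fix R assume "R \<in> ?L"
      then obtain S where S: "S \<subseteq> {..<m}" "S \<noteq> {}" "doubly_covered P R S" by auto
      have "card S \<in> {1..m}"
        using S card_mono[of "{..<m}" S] finite_subset[of S "{..<m}"]
        by (auto simp: Suc_le_eq card_gt_0_iff)
      moreover have "S \<in> subsets_of_card {..<m} (card S)" using S by (simp add: subsets_of_card_def)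
      ultimately show "R \<in> ?R" using S(3) by blast
    qed
  qed
  have "measure_pmf.prob ?p {R. \<exists>S\<subseteq>{..<m}. S \<noteq> {} \<and> doubly_covered P R S} \<le>
      (\<Sum>t\<in>{1..m}. measure_pmf.prob ?p
        (\<Union>S\<in>subsets_of_card {..<m} t. {R. doubly_covered P R S}))"
    unfolding eq by (intro measure_pmf.finite_measure_subadditive_finite) auto
  also have "\<dots> \<le> (\<Sum>t\<in>{1..m}. \<delta> ^ t)"
  proof (rule sum_mono)
    fix t assume t: "t \<in> {1..m}"
    have "measure_pmf.prob ?p (\<Union>S\<in>subsets_of_card {..<m} t. {R. doubly_covered P R S}) \<le>
        (\<Sum>S\<in>subsets_of_card {..<m} t. measure_pmf.prob ?p {R. doubly_covered P R S})"
      by (intro measure_pmf.finite_measure_subadditive_finite) auto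
    also have "\<dots> \<le> \<delta> ^ t" by (rule fixed_card[OF t])
    finally show "measure_pmf.prob ?p
        (\<Union>S\<in>subsets_of_card {..<m} t. {R. doubly_covered P R S}) \<le> \<delta> ^ t" .
  qed
  also have "\<dots> = \<delta> * (\<Sum>t<m. \<delta> ^ t)"
    by (simp add: sum.atLeast1_atMost_eq sum_distrib_left)
  also have "\<dots> \<le> \<delta> * 2"
  proof (rule mult_left_mono[OF _ d0])
    \<comment> \<open>Finite geometric sum; \<open>\<delta> \<le> 1 / 2\<close> bounds it by
      2.\<close>
    have "(1 - \<delta>) * (\<Sum>t<m. \<delta> ^ t) = 1 - \<delta> ^ m" by (simp add: one_diff_power_eq)
    also have "\<dots> \<le> 1" using d0 by simp
    finally have "(1 - \<delta>) * (\<Sum>t<m. \<delta> ^ t) \<le> 1" .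
    moreover have "1 / 2 * (\<Sum>t<m. \<delta> ^ t) \<le> (1 - \<delta>) * (\<Sum>t<m. \<delta> ^ t)"
      using assms(8) d0 by (intro mult_right_mono sum_nonneg) auto
    ultimately show "(\<Sum>t<m. \<delta> ^ t) \<le> 2" by simp
  qed
  finally show ?thesis by simp
qed

section \<open>Hypergraphs of crossing edges\<close>

definition crossing_edges :: "nat \<Rightarrow> 'a set \<Rightarrow> 'a set \<Rightarrow> 'a set \<Rightarrow> 'a set set" where
  "crossing_edges k V X Y = {e \<in> subsets_of_card V k. e \<inter> X \<noteq> {} \<and> e \<inter> Y \<noteq> {}}"

text \<open>The vertices outside \<open>X \<union> Y\<close> stay unconstrained; this freedom is
  what accommodates the random tuples.\<close>

lemma two_coloring_crossing_edges:
  assumes "X \<subseteq> A" "A \<subseteq> V" "A \<inter> Y = {}"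
  shows "two_coloring (V, crossing_edges k V X Y) A (V - A)"
  using assms unfolding two_coloring_def crossing_edges_def by auto

text \<open>Count only the edges with exactly one vertex in \<open>X\<close> and one in
  \<open>Y\<close>. Such an edge determines the triple it was built from: its traces on
  \<open>X\<close> and \<open>Y\<close>, and the rest.\<close>

lemma card_crossing_edges_ge:
  assumes "finite V" "X \<subseteq> V" "Y \<subseteq> V" "X \<inter> Y = {}" "2 \<le> k"
  shows "card X * card Y * (card (V - (X \<union> Y)) choose (k - 2)) \<le> card (crossing_edges k V X Y)"
proof -
  define T where "T = X \<times> Y \<times> subsets_of_card (V - (X \<union> Y)) (k - 2)"
  define f where "f = (\<lambda>(x, y, Z). insert x (insert y Z) :: 'a set)"
  have "f ` T \<subseteq> crossing_edges k V X Y"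
  proof
    fix e assume "e \<in> f ` T"
    then obtain x y Z where e: "e = insert x (insert y Z)" "x \<in> X" "y \<in> Y"
        "Z \<subseteq> V - (X \<union> Y)" "card Z = k - 2"
      by (auto simp: f_def T_def subsets_of_card_def)
    have "finite Z" "x \<notin> insert y Z" "y \<notin> Z" using e assms by (auto intro: finite_subset)
    hence "card e = k" using e assms(5) by simp
    thus "e \<in> crossing_edges k V X Y"
      using e assms by (auto simp: crossing_edges_def subsets_of_card_def)
  qed
  moreover have "inj_on f T"
  proof (rule inj_on_inverseI)
    fix q assume q: "q \<in> T"
    obtain x y Z where xyZ: "q = (x, y, Z)" by (cases q)
    have "f q \<inter> X = {x}" "f q \<inter> Y = {y}" "f q - (X \<union> Y) = Z"
      using q assms(4) by (auto simp: f_def T_def xyZ subsets_of_card_def)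
    thus "(\<lambda>e. (the_elem (e \<inter> X), the_elem (e \<inter> Y), e - (X \<union> Y))) (f q) = q"
      by (simp add: xyZ)
  qed
  moreover have "finite (crossing_edges k V X Y)"
    using assms(1) by (auto simp: crossing_edges_def)
  ultimately have "card T \<le> card (crossing_edges k V X Y)" by (metis card_inj_on_le)
  thus ?thesis using assms(1) by (simp add: T_def card_cartesian_product card_subsets_of_card)
qed

text \<open>If no nonempty family of tuples is doubly covered, the colouring that separates
  \<open>X\<close> from \<open>Y\<close> extends to all tuples by \<open>coloring_extends\<close>.
  The argument runs on the support of the distribution, where every tuple is an
  \<open>l\<close>-subset of \<open>V\<close>.\<close>

lemma prob_two_colorable_crossing_edges_ge:
  fixes V X Y :: "'a set" and l m :: nat
  defines "n \<equiv> card V"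
  defines "\<delta> \<equiv> exp 2 * real (2 * l * l) ^ l *
    (real m * (real (card (X \<union> Y)) / n) ^ l + real m / n)"
  assumes V: "finite V" "2 \<le> l" "l \<le> n" and XY: "X \<subseteq> V" "Y \<subseteq> V" "X \<inter> Y = {}"
    and m: "m \<le> n" "\<delta> \<le> 1 / 2"
  shows "1 - 2 * \<delta> \<le> measure_pmf.prob (random_tuples V l m)
    {R. two_colorable (add_edges (V, crossing_edges k V X Y) (R ` {..<m}))}"
proof -
  let ?p = "random_tuples V l m"
  define B where "B = {R. \<exists>S\<subseteq>{..<m}. S \<noteq> {} \<and> doubly_covered (X \<union> Y) R S}"
  let ?C = "{R. two_colorable (add_edges (V, crossing_edges k V X Y) (R ` {..<m}))}"
  have "R \<in> ?C" if R: "R \<in> set_pmf ?p" "R \<notin> B" for R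
  proof -
    have ln: "l \<le> card V" using V by (simp add: n_def)
    note R' = set_pmf_random_tuples[OF V(1) ln R(1)]
    have "\<exists>A. X \<subseteq> A \<and> A \<inter> Y = {} \<and> (\<forall>i\<in>{..<m}. \<not> R i \<subseteq> A \<and> R i \<inter> A \<noteq> {})"
      using R(2) R' V(2) XY(3) by (intro coloring_extends) (auto simp: B_def)
    then obtain A where A: "X \<subseteq> A" "A \<inter> Y = {}" "\<forall>i<m. \<not> R i \<subseteq> A \<and> R i \<inter> A \<noteq> {}"
      by auto
    \<comment> \<open>\<open>coloring_extends\<close> does not confine \<open>A\<close> to
      \<open>V\<close>, hence the intersection.\<close>
    have "two_coloring (V, crossing_edges k V X Y) (A \<inter> V) (V - A \<inter> V)"
      using A(1,2) XY by (intro two_coloring_crossing_edges) auto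
    moreover have "\<not> R i \<subseteq> A \<inter> V \<and> \<not> R i \<subseteq> V - A \<inter> V" if "i < m" for i
      using A(3) R'(1)[OF that] that by blast
    ultimately have "two_coloring (add_edges (V, crossing_edges k V X Y) (R ` {..<m}))
        (A \<inter> V) (V - A \<inter> V)"
      unfolding two_coloring_def add_edges_def by auto
    thus ?thesis unfolding two_colorable_def by blast
  qed
  hence "measure_pmf.prob ?p (UNIV - B) \<le> measure_pmf.prob ?p ?C"
    by (intro measure_pmf.finite_measure_mono_AE) (auto simp: AE_measure_pmf_iff)
  moreover have "measure_pmf.prob ?p (UNIV - B) = 1 - measure_pmf.prob ?p B"
    using measure_pmf.prob_compl[of B ?p] by simp
  moreover have "measure_pmf.prob ?p B \<le> 2 * \<delta>"
    unfolding B_def \<delta>_def n_def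
    using V XY m by (intro prob_ex_doubly_covered_le) (auto simp: n_def \<delta>_def)
  ultimately show ?thesis by simp
qed

section \<open>Choice of the parameters and asymptotics in \<open>n\<close>\<close>

theorem theorem1p2:
  fixes k l :: nat and \<epsilon> :: real
  assumes "k \<ge> 2" and "l \<ge> 2" and "0 \<le> \<epsilon>" and "\<epsilon> < 2 / real l"
  shows "\<exists>H :: nat \<Rightarrow> nat hypergraph.
    (\<forall>n. fst (H n) = {..<n} \<and> uniform_hypergraph k (H n) \<and> two_colorable (H n)) \<and>
    (\<lambda>n. real (card (snd (H n)))) \<in> \<Omega>(\<lambda>n. real n powr (real k - \<epsilon>)) \<and>
    (\<forall>m :: nat \<Rightarrow> nat.
       (\<lambda>n. real (m n)) \<in> o(\<lambda>n. real n powr (real l * \<epsilon> / 2)) \<longrightarrow>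
       (\<lambda>n. measure_pmf.prob (random_tuples {..<n} l (m n))
              {R. two_colorable (add_edges (H n) (R ` {..<m n}))}) \<longlonglongrightarrow> 1)"
proof -
  \<comment> \<open>The first bound will give \<open>m n \<le> n\<close> eventually; the second
    makes the exponent of \<open>b\<close> positive.\<close>
  have eps: "l * \<epsilon> / 2 \<le> 1" "\<epsilon> < 1"
  proof -
    show "l * \<epsilon> / 2 \<le> 1" using assms by (simp add: field_simps)
    have "2 / real l \<le> 1" using assms(2) by simp
    thus "\<epsilon> < 1" using assms(4) by linarith
  qed
  \<comment> \<open>With |X| and |Y| of order n^(1 - \<epsilon>/2), the pairs in X x Y number about
    n^(2 - \<epsilon>), and (|X \<union> Y|/n)^l is at most n^(-l\<epsilon>/2), which matches the
    bound on \<open>m\<close>. The quarter leaves at least half of the vertices outside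
    \<open>X \<union> Y\<close>.\<close>
  define b where "b n = real n powr (1 - \<epsilon> / 2)" for n
  define a where "a n = nat \<lfloor>b n / 4\<rfloor>" for n
  define X where "X n = {..<a n}" for n
  define Y where "Y n = {a n..<2 * a n}" for n
  define H where "H n = ({..<n}, crossing_edges k {..<n} (X n) (Y n))" for n
  have b0: "0 \<le> b n" for n by (simp add: b_def)
  have bn: "b n \<le> n" for n
  proof (cases "n = 0")
    case False
    hence "b n \<le> real n powr 1" unfolding b_def using assms by (intro powr_mono) auto
    thus ?thesis using False by simp
  qed (simp add: b_def)
  have ab: "real (a n) \<le> b n / 4" for n
    unfolding a_def using b0[of n] by linarith
  have an: "4 * a n \<le> n" for n
    using ab[of n] bn[of n] by (simp flip: of_nat_le_iff[where 'a = real])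
  have XY: "X n \<subseteq> {..<n}" "Y n \<subseteq> {..<n}" "X n \<inter> Y n = {}" for n
    using an[of n] by (auto simp: X_def Y_def)
  have card_XY: "card (X n \<union> Y n) = 2 * a n" for n
  proof -
    have "X n \<union> Y n = {..<2 * a n}" by (auto simp: X_def Y_def)
    thus ?thesis by simp
  qed

  \<comment> \<open>Uniformity and 2-colourability of \<open>H n\<close>\<close>
  have 1: "fst (H n) = {..<n} \<and> uniform_hypergraph k (H n) \<and> two_colorable (H n)" for n
  proof -
    have "two_coloring (H n) (X n) ({..<n} - X n)"
      unfolding H_def using XY[of n] by (intro two_coloring_crossing_edges) auto
    thus ?thesis unfolding two_colorable_def
      by (auto simp: H_def uniform_hypergraph_def crossing_edges_def)
  qed

  \<comment> \<open>Number of edges\<close>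
  have 2: "(\<lambda>n. real (card (snd (H n)))) \<in> \<Omega>(\<lambda>n. real n powr (real k - \<epsilon>))"
  proof (rule landau_omega.bigI)
    \<comment> \<open>1/64 comes from \<open>a n \<ge> b n / 8\<close>, squared; the other factor
      from choosing \<open>k - 2\<close> further vertices among at least n/2.\<close>
    show "1 / 64 * (1 / (2 * real k)) ^ (k - 2) > 0" using assms(1) by simp
    have "filterlim b at_top at_top"
      unfolding b_def using eps by real_asymp
    \<comment> \<open>From 8 on, rounding b/4 down still leaves at least b/8.\<close>
    hence "eventually (\<lambda>n. 8 \<le> b n) at_top" by (simp add: filterlim_at_top)
    thus "eventually (\<lambda>n. norm (real (card (snd (H n)))) \<ge>
        1 / 64 * (1 / (2 * real k)) ^ (k - 2) * norm (real n powr (real k - \<epsilon>))) at_top"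
      using eventually_ge_at_top[of "2 * k"]
    proof eventually_elim
      case (elim n)
      have n: "0 < n" using elim assms(1) by simp
      let ?N = "n - 2 * a n"
      have N: "real n / 2 \<le> real ?N" "k - 2 \<le> ?N" using an[of n] elim by auto
      have "b n / 8 \<le> a n" unfolding a_def using elim by linarith
      hence "(b n / 8)\<^sup>2 \<le> (real (a n))\<^sup>2" using b0 by (intro power_mono) auto
      moreover have "(b n)\<^sup>2 = real n powr (2 - \<epsilon>)"
        using n by (simp add: b_def power2_eq_square flip: powr_add)
      ultimately have a2: "1 / 64 * real n powr (2 - \<epsilon>) \<le> real (a n) * real (a n)"
        by (simp add: power2_eq_square)
      have "(real n / (2 * real k)) ^ (k - 2) \<le> (real ?N / real (k - 2)) ^ (k - 2)"
      \<comment> \<open>For k = 2 the divisor \<open>k - 2\<close> vanishes, but both powers have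
        exponent 0.\<close>
      proof (cases "k = 2")
        case False
        have "real n / (2 * real k) = real n / 2 / real k" by simp
        also have "\<dots> \<le> real ?N / real (k - 2)"
          using N False assms(1) by (intro frac_le) auto
        finally show ?thesis by (intro power_mono) auto
      qed simp
      also have "\<dots> \<le> real (?N choose (k - 2))"
        using N by (intro binomial_ge_n_over_k_pow_k)
      finally have N': "(real n / (2 * real k)) ^ (k - 2) \<le> real (?N choose (k - 2))" .
      have "real k - \<epsilon> = (2 - \<epsilon>) + real (k - 2)" using assms(1) by simp
      hence "real n powr (real k - \<epsilon>) = real n powr (2 - \<epsilon>) * real n ^ (k - 2)"
        using n by (simp only: powr_add powr_realpow of_nat_0_less_iff)
      hence "1 / 64 * (1 / (2 * real k)) ^ (k - 2) * norm (real n powr (real k - \<epsilon>)) =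
          1 / 64 * real n powr (2 - \<epsilon>) * (real n / (2 * real k)) ^ (k - 2)"
        by (simp add: power_divide)
      also have "\<dots> \<le> real (a n) * real (a n) * real (?N choose (k - 2))"
        by (rule mult_mono[OF a2 N']) auto
      also have "\<dots> = real (card (X n) * card (Y n) *
          (card ({..<n} - (X n \<union> Y n)) choose (k - 2)))"
      proof -
        have "card ({..<n} - (X n \<union> Y n)) = ?N"
          using XY[of n] card_XY[of n] by (subst card_Diff_subset) (auto intro: finite_subset)
        thus ?thesis by (simp add: X_def Y_def)
      qed
      also have "\<dots> \<le> real (card (snd (H n)))"
        unfolding H_def snd_conv using XY assms(1)
        by (intro of_nat_mono card_crossing_edges_ge) auto
      finally show ?case by simp
    qed
  qed

  \<comment> \<open>Almost sure 2-colourability\<close>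
  have 3: "(\<lambda>n. measure_pmf.prob (random_tuples {..<n} l (m n))
      {R. two_colorable (add_edges (H n) (R ` {..<m n}))}) \<longlonglongrightarrow> 1"
    if m: "(\<lambda>n. real (m n)) \<in> o(\<lambda>n. real n powr (real l * \<epsilon> / 2))" for m :: "nat \<Rightarrow> nat"
  proof -
    define K where "K = exp 2 * real (2 * l * l) ^ l"
    define r where "r n = real (m n) / real n powr (real l * \<epsilon> / 2)" for n
    have K0: "0 \<le> K" by (simp add: K_def)
    have r: "r \<longlonglongrightarrow> 0" unfolding r_def by (rule smalloD_tendsto[OF m])
    hence lim: "(\<lambda>n. 2 * K * r n) \<longlonglongrightarrow> 0" by (auto intro: tendsto_mult_right_zero)
    \<comment> \<open>Both summands in \<open>\<delta>\<close> are at most \<open>r n\<close> up to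
      the factor \<open>K\<close>, so \<open>\<delta> \<le> 2 * K * r n\<close>. Eventually 2Kr <
      1/2 gives \<open>\<delta> \<le> 1 / 2\<close>, and r < 1 gives
      \<open>m n \<le> n\<close>.\<close>
    have ev: "eventually (\<lambda>n. 1 - 2 * (2 * K * r n) \<le>
        measure_pmf.prob (random_tuples {..<n} l (m n))
          {R. two_colorable (add_edges (H n) (R ` {..<m n}))}) at_top"
      using order_tendstoD(2)[OF lim half_gt_zero[OF zero_less_one]]
        order_tendstoD(2)[OF r zero_less_one] eventually_ge_at_top[of l]
    proof eventually_elim
      case (elim n)
      have n: "1 \<le> n" "0 < real n" using elim assms(2) by auto
      define \<delta> where "\<delta> = exp 2 * real (2 * l * l) ^ l *
        (real (m n) * (real (card (X n \<union> Y n)) / card {..<n}) ^ l + real (m n) / card {..<n})"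
      have le_n: "real n powr (real l * \<epsilon> / 2) \<le> n"
        using powr_mono[OF eps(1), of "real n"] n by simp
      have "real (m n) \<le> real n powr (real l * \<epsilon> / 2)"
        using elim(2) n by (simp add: r_def divide_less_eq)
      hence mn: "m n \<le> n" using le_n by linarith
      have "real (card (X n \<union> Y n)) / n \<le> b n / n"
        using ab[of n] b0[of n] n by (intro divide_right_mono) (auto simp: card_XY)
      also have "\<dots> = real n powr (- (\<epsilon> / 2))"
        using n powr_diff[of "real n" "1 - \<epsilon> / 2" 1] by (simp add: b_def)
      finally have "(real (card (X n \<union> Y n)) / n) ^ l \<le> (real n powr (- (\<epsilon> / 2))) ^ l"
        by (intro power_mono) auto
      also have "\<dots> = real n powr (- (real l * \<epsilon> / 2))"
        using n by (simp add: powr_powr mult.commute flip: powr_realpow)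
      finally have "real (m n) * (real (card (X n \<union> Y n)) / n) ^ l \<le>
          real (m n) * real n powr (- (real l * \<epsilon> / 2))"
        by (intro mult_left_mono) auto
      also have "\<dots> = r n" by (simp only: r_def powr_minus divide_inverse)
      finally have "real (m n) * (real (card (X n \<union> Y n)) / n) ^ l \<le> r n" .
      moreover have "real (m n) / n \<le> r n"
        unfolding r_def using le_n n by (intro divide_left_mono) auto
      ultimately have "\<delta> \<le> K * (r n + r n)"
        unfolding \<delta>_def K_def[symmetric] using K0
        by (intro mult_left_mono add_mono) auto
      hence \<delta>: "\<delta> \<le> 2 * K * r n" by simp
      hence half: "\<delta> \<le> 1 / 2" using elim(1) by linarith
      have "1 - 2 * \<delta> \<le> measure_pmf.prob (random_tuples {..<n} l (m n))
          {R. two_colorable (add_edges (H n) (R ` {..<m n}))}"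
        unfolding \<delta>_def H_def using XY[of n] mn elim(3) half[unfolded \<delta>_def] assms(2)
        by (intro prob_two_colorable_crossing_edges_ge) auto
      thus ?case using \<delta> by simp
    qed
    have "(\<lambda>n. 1 - 2 * (2 * K * r n)) \<longlonglongrightarrow> 1 - 2 * 0"
      by (intro tendsto_intros lim)
    thus ?thesis
      \<comment> \<open>The upper bound is the constant 1, as these are probabilities.\<close>
      by (intro tendsto_sandwich[OF ev _ _ tendsto_const]) auto
  qed

  show ?thesis using 1 2 3 by (intro exI[of _ H]) blast
qed

end
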